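(* For every functor $K:\mathcal V\text{-}\mathsf{Cat}\to\mathcal V\text{-}\mathsf{Cat}$, the assignment $X\mapsto KX$ on $\mathcal V$-categories and $$\tilde K\varphi := (Ky_{\varphi})^*\cdot (Ky_X)_* : KX\to K\hat X\to KY$$ on $\mathcal V$-modules $\varphi:X\to Y$ defines a lax functor $\tilde K:\mathcal V\text{-}\mathsf{Mod}\to\mathcal V\text{-}\mathsf{Mod}$ which coincides with $K$ on objects. Moreover, if $K$ preserves full fidelity of $\mathcal V$-functors, then $\tilde K(f^* )=(Kf)^*$ for every $\mathcal V$-functor $f$; that is, $\tilde K\circ(-)^*=(-)^*\circ K^{\mathrm{op}}$ as assignments $(\mathcal V\text{-}\mathsf{Cat})^{\mathrm{op}}\to\mathcal V\text{-}\mathsf{Mod}$.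
   Context: $\mathcal V$ is a commutative unital quantale: a complete lattice with a commutative, associative operation $\otimes$ with neutral element $k$, such that $\otimes$ preserves arbitrary suprema in each variable; it is assumed that $k>\bot$. The internal hom $\multimap$ of $\mathcal V$ is given by $z\le x\multimap y\iff z\otimes x\le y$. A $\mathcal V$-category $X=(X,a)$ is a set $X$ with $a:X\times X\to\mathcal V$ satisfying $k\le a(x,x)$ and $a(x,y)\otimes a(y,z)\le a(x,z)$; one writes $1_X^*:=a$. A $\mathcal V$-functor $f:(X,a)\to(Y,b)$ is a map with $a(x,y)\le b(f(x),f(y))$ for all $x,y$; it is fully faithful if equality always holds. "$K$ preserves full fidelity" means that $Kf$ is fully faithful whenever $f$ is. $\mathcal V\text{-}\mathsf{Cat}$ is the resulting category. A $\mathcal V$-module $\varphi:X\to Y$ between $\mathcal V$-categories $(X,a)$, $(Y,b)$ is a function $\varphi:X\times Y\to\mathcal V$ with $a(x',x)\otimes\varphi(x,y)\le\varphi(x',y)$ and $\varphi(x,y)\otimes b(y,y')\le\varphi(x,y')$. Composition: $(\psi\cdot\varphi)(x,z)=\bigvee_{y\in Y}\varphi(x,y)\otimes\psi(y,z)$; the identity on $X$ is $1_X^*=a$. This gives the category $\mathcal V\text{-}\mathsf{Mod}$, whose hom-sets are ordered pointwise. For a $\mathcal V$-functor $f:(X,a)\to(Y,b)$ there are $\mathcal V$-modules $f_*:X\to Y$, $f_*(x,y)=b(f(x),y)$, and $f^*:Y\to X$, $f^*(y,x)=b(y,f(x))$; $(-)_*$ and $(-)^*$ are functors $\mathcal V\text{-}\mathsf{Cat}\to\mathcal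 V\text{-}\mathsf{Mod}$ and $(\mathcal V\text{-}\mathsf{Cat})^{\mathrm{op}}\to\mathcal V\text{-}\mathsf{Mod}$, identical on objects. $\hat X$ is the $\mathcal V$-category of all $\mathcal V$-functors $X^{\mathrm{op}}\to\mathcal V$, i.e. of all functions $t:X\to\mathcal V$ with $a(x',x)\otimes t(x)\le t(x')$, with structure $1_{\hat X}^*(t,s)=\bigwedge_{x\in X}t(x)\multimap s(x)$. The Yoneda functor is $y_X:X\to\hat X$, $y_X(x)=a(-,x)$. For a $\mathcal V$-module $\varphi:X\to Y$ its Yoneda mate is the $\mathcal V$-functor $y_\varphi:Y\to\hat X$, $y_\varphi(y)=\varphi(-,y)$. A lax functor here means an assignment on objects and morphisms with $1_{KX}^*\le\tilde K(1_X^* )$ for all $X$ and $\tilde K\psi\cdot\tilde K\varphi\le\tilde K(\psi\cdot\varphi)$ for all composable $\mathcal V$-modules. *)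

theory Defs
  imports Main "HOL-Library.FuncSet"
begin

section \<open>Commutative unital quantales\<close>

text \<open>
  The tensor is written \<open>*\<close> and its neutral element \<open>1\<close>. By commutativity it is
  enough to ask for preservation of suprema in one variable.
\<close>

class comm_quantale = complete_lattice + comm_monoid_mult +
  assumes mult_Sup: "x * Sup A = (SUP y\<in>A. x * y)"
    and bot_less_one: "bot < 1"

definition residual :: "'v::comm_quantale \<Rightarrow> 'v \<Rightarrow> 'v" (infixr "\<multimap>" 60)
  where "x \<multimap> y = Sup {z. z * x \<le> y}"

lemma le_residual_iff: "z \<le> x \<multimap> y \<longleftrightarrow> z * x \<le> y" for x y z :: "'v::comm_quantale"
proof
  assume *: "z \<le> x \<multimap> y"
  have mono: "x * a \<le> x * b" if "a \<le> b" for a b :: 'v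
  proof -
    have "x * b = x * Sup {a, b}"
      using that by (simp add: sup_absorb2)
    also have "\<dots> = sup (x * a) (x * b)"
      by (simp only: mult_Sup) simp
    finally show ?thesis
      by (simp add: le_iff_sup)
  qed
  have "z * x \<le> x * (x \<multimap> y)"
    using mono[OF *] by (simp add: mult.commute)
  also have "\<dots> \<le> y"
    by (auto simp: residual_def mult_Sup mult.commute intro!: SUP_least)
  finally show "z * x \<le> y" .
qed (auto simp: residual_def intro: Sup_upper)


section \<open>The size convention\<close>

text \<open>
  The category of \<open>\<V>\<close>-categories has to contain the presheaf \<open>\<V>\<close>-category of each of its
  objects. No type contains a copy of every set of functions \<open>A \<Rightarrow> \<V>\<close> with
  \<open>A\<close> a set of elements of that type, so, as in the usual set-theoretic foundations, the
  underlying sets are taken from a universe \<open>U\<close> of small sets. Of \<open>U\<close> only the following is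
  required: subsets of small sets are small, and for small \<open>A\<close> the set of all functions from
  \<open>A\<close> to \<open>\<V>\<close> is, up to the bijection \<open>code A\<close>, again small. For instance, a Grothendieck
  universe containing the underlying set of \<open>\<V>\<close> provides such a \<open>U\<close>.

  Functions on \<open>A\<close> with values in \<open>\<V>\<close> are represented by total functions with value
  \<open>bot\<close> outside \<open>A\<close>; the same convention is used for \<open>\<V>\<close>-category structures and
  \<open>\<V>\<close>-modules, so that equality in the logic is equality on the intended domains.
\<close>

definition vmaps :: "'u set \<Rightarrow> ('u \<Rightarrow> 'v::comm_quantale) set"
  where "vmaps A = {t. \<forall>x. x \<notin> A \<longrightarrow> t x = bot}"

definition small_universe :: "'u set set \<Rightarrow> ('u set \<Rightarrow> ('u \<Rightarrow> 'v::comm_quantale) \<Rightarrow> 'u) \<Rightarrow> bool"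
  where "small_universe U code \<longleftrightarrow>
    (\<forall>A\<in>U. \<forall>B. B \<subseteq> A \<longrightarrow> B \<in> U) \<and>
    (\<forall>A\<in>U. inj_on (code A) (vmaps A) \<and> code A ` vmaps A \<in> U)"

text \<open>The coding is no restriction on \<open>U\<close> beyond closure under \<open>\<V>\<close>-powers up to bijection.\<close>

lemma small_universe_code_exists:
  assumes "\<And>A B. A \<in> U \<Longrightarrow> B \<subseteq> A \<Longrightarrow> B \<in> U"
    and "\<And>A. A \<in> U \<Longrightarrow> \<exists>B\<in>U. \<exists>g. bij_betw g (vmaps A :: ('u \<Rightarrow> 'v::comm_quantale) set) B"
  shows "\<exists>code :: 'u set \<Rightarrow> ('u \<Rightarrow> 'v) \<Rightarrow> 'u. small_universe U code"
proof -
  have "\<forall>A\<in>U. \<exists>g :: ('u \<Rightarrow> 'v) \<Rightarrow> 'u. inj_on g (vmaps A) \<and> g ` vmaps A \<in> U"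
    using assms(2) by (fastforce simp: bij_betw_def)
  then show ?thesis
    using assms(1) unfolding small_universe_def by metis
qed


section \<open>Categories and functors enriched in a quantale\<close>

record ('u, 'v) vcat =
  carrier :: "'u set"
  hom :: "'u \<Rightarrow> 'u \<Rightarrow> 'v"

definition is_vcat :: "('u, 'v::comm_quantale) vcat \<Rightarrow> bool"
  where "is_vcat X \<longleftrightarrow>
    (\<forall>x\<in>carrier X. 1 \<le> hom X x x) \<and>
    (\<forall>x\<in>carrier X. \<forall>y\<in>carrier X. \<forall>z\<in>carrier X. hom X x y * hom X y z \<le> hom X x z) \<and>
    (\<forall>x y. x \<notin> carrier X \<or> y \<notin> carrier X \<longrightarrow> hom X x y = bot)"

definition VCat :: "'u set set \<Rightarrow> ('u, 'v::comm_quantale) vcat set"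
  where "VCat U = {X. is_vcat X \<and> carrier X \<in> U}"

definition vfunctor ::
    "('u, 'v::comm_quantale) vcat \<Rightarrow> ('u, 'v) vcat \<Rightarrow> ('u \<Rightarrow> 'u) \<Rightarrow> bool"
  where "vfunctor X Y f \<longleftrightarrow>
    f \<in> carrier X \<rightarrow>\<^sub>E carrier Y \<and>
    (\<forall>x\<in>carrier X. \<forall>y\<in>carrier X. hom X x y \<le> hom Y (f x) (f y))"

definition fully_faithful ::
    "('u, 'v::comm_quantale) vcat \<Rightarrow> ('u, 'v) vcat \<Rightarrow> ('u \<Rightarrow> 'u) \<Rightarrow> bool"
  where "fully_faithful X Y f \<longleftrightarrow>
    vfunctor X Y f \<and> (\<forall>x\<in>carrier X. \<forall>y\<in>carrier X. hom X x y = hom Y (f x) (f y))"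

text \<open>
  An assignment on objects and morphisms; \<open>on_mor F X Y f\<close> is the value at the morphism \<open>f\<close>
  from \<open>X\<close> to \<open>Y\<close>.
\<close>

record ('o, 'm) assignment =
  on_ob :: "'o \<Rightarrow> 'o"
  on_mor :: "'o \<Rightarrow> 'o \<Rightarrow> 'm \<Rightarrow> 'm"

definition VCat_functor ::
    "'u set set \<Rightarrow> (('u, 'v::comm_quantale) vcat, 'u \<Rightarrow> 'u) assignment \<Rightarrow> bool"
  where "VCat_functor U K \<longleftrightarrow>
    (\<forall>X\<in>VCat U. on_ob K X \<in> VCat U) \<and>
    (\<forall>X\<in>VCat U. \<forall>Y\<in>VCat U. \<forall>f. vfunctor X Y f \<longrightarrow>
       vfunctor (on_ob K X) (on_ob K Y) (on_mor K X Y f)) \<and>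
    (\<forall>X\<in>VCat U. on_mor K X X (restrict id (carrier X)) = restrict id (carrier (on_ob K X))) \<and>
    (\<forall>X\<in>VCat U. \<forall>Y\<in>VCat U. \<forall>Z\<in>VCat U. \<forall>f g. vfunctor X Y f \<longrightarrow> vfunctor Y Z g \<longrightarrow>
       on_mor K X Z (compose (carrier X) g f) =
       compose (carrier (on_ob K X)) (on_mor K Y Z g) (on_mor K X Y f))"

definition preserves_full_fidelity ::
    "'u set set \<Rightarrow> (('u, 'v::comm_quantale) vcat, 'u \<Rightarrow> 'u) assignment \<Rightarrow> bool"
  where "preserves_full_fidelity U K \<longleftrightarrow>
    (\<forall>X\<in>VCat U. \<forall>Y\<in>VCat U. \<forall>f. fully_faithful X Y f \<longrightarrow>
       fully_faithful (on_ob K X) (on_ob K Y) (on_mor K X Y f))"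


section \<open>Modules\<close>

definition vmodule ::
    "('u, 'v::comm_quantale) vcat \<Rightarrow> ('u, 'v) vcat \<Rightarrow> ('u \<Rightarrow> 'u \<Rightarrow> 'v) \<Rightarrow> bool"
  where "vmodule X Y \<phi> \<longleftrightarrow>
    (\<forall>x'\<in>carrier X. \<forall>x\<in>carrier X. \<forall>y\<in>carrier Y. hom X x' x * \<phi> x y \<le> \<phi> x' y) \<and>
    (\<forall>x\<in>carrier X. \<forall>y\<in>carrier Y. \<forall>y'\<in>carrier Y. \<phi> x y * hom Y y y' \<le> \<phi> x y') \<and>
    (\<forall>x y. x \<notin> carrier X \<or> y \<notin> carrier Y \<longrightarrow> \<phi> x y = bot)"

text \<open>
  \<open>mod_comp Y \<psi> \<phi>\<close> is \<open>\<psi> \<cdot> \<phi>\<close> with intermediate object \<open>Y\<close>. It is \<open>bot\<close> outside the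
  intended domain, since \<open>bot * v = bot\<close>.
\<close>

definition mod_comp ::
    "('u, 'v::comm_quantale) vcat \<Rightarrow> ('u \<Rightarrow> 'u \<Rightarrow> 'v) \<Rightarrow> ('u \<Rightarrow> 'u \<Rightarrow> 'v) \<Rightarrow> 'u \<Rightarrow> 'u \<Rightarrow> 'v"
  where "mod_comp Y \<psi> \<phi> = (\<lambda>x z. SUP y\<in>carrier Y. \<phi> x y * \<psi> y z)"

definition lower_star ::
    "('u, 'v::comm_quantale) vcat \<Rightarrow> ('u, 'v) vcat \<Rightarrow> ('u \<Rightarrow> 'u) \<Rightarrow> 'u \<Rightarrow> 'u \<Rightarrow> 'v"
  where "lower_star X Y f =
    (\<lambda>x y. if x \<in> carrier X \<and> y \<in> carrier Y then hom Y (f x) y else bot)"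

definition upper_star ::
    "('u, 'v::comm_quantale) vcat \<Rightarrow> ('u, 'v) vcat \<Rightarrow> ('u \<Rightarrow> 'u) \<Rightarrow> 'u \<Rightarrow> 'u \<Rightarrow> 'v"
  where "upper_star X Y f =
    (\<lambda>y x. if y \<in> carrier Y \<and> x \<in> carrier X then hom Y y (f x) else bot)"

text \<open>
  Monotonicity on hom-sets is not part of this notion of lax functor. The order on modules is
  the pointwise order of functions, and the identity module on \<open>X\<close> is \<open>hom X\<close>.
\<close>

definition VMod_lax_functor ::
    "'u set set \<Rightarrow> (('u, 'v::comm_quantale) vcat, 'u \<Rightarrow> 'u \<Rightarrow> 'v) assignment \<Rightarrow> bool"
  where "VMod_lax_functor U F \<longleftrightarrow>
    (\<forall>X\<in>VCat U. on_ob F X \<in> VCat U) \<and>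
    (\<forall>X\<in>VCat U. \<forall>Y\<in>VCat U. \<forall>\<phi>. vmodule X Y \<phi> \<longrightarrow>
       vmodule (on_ob F X) (on_ob F Y) (on_mor F X Y \<phi>)) \<and>
    (\<forall>X\<in>VCat U. hom (on_ob F X) \<le> on_mor F X X (hom X)) \<and>
    (\<forall>X\<in>VCat U. \<forall>Y\<in>VCat U. \<forall>Z\<in>VCat U. \<forall>\<phi> \<psi>. vmodule X Y \<phi> \<longrightarrow> vmodule Y Z \<psi> \<longrightarrow>
       mod_comp (on_ob F Y) (on_mor F Y Z \<psi>) (on_mor F X Y \<phi>)
         \<le> on_mor F X Z (mod_comp Y \<psi> \<phi>))"


section \<open>Presheaves and Yoneda mates\<close>

definition presheaves :: "('u, 'v::comm_quantale) vcat \<Rightarrow> ('u \<Rightarrow> 'v) set"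
  where "presheaves X =
    {t \<in> vmaps (carrier X). \<forall>x'\<in>carrier X. \<forall>x\<in>carrier X. hom X x' x * t x \<le> t x'}"

text \<open>The elements of \<open>hat code X\<close> are the codes of presheaves on \<open>X\<close>.\<close>

definition hat ::
    "('u set \<Rightarrow> ('u \<Rightarrow> 'v::comm_quantale) \<Rightarrow> 'u) \<Rightarrow> ('u, 'v) vcat \<Rightarrow> ('u, 'v) vcat"
  where "hat code X =
    (let C = code (carrier X) ` presheaves X;
         dec = inv_into (presheaves X) (code (carrier X))
     in \<lparr>carrier = C,
         hom = (\<lambda>p q. if p \<in> C \<and> q \<in> C then (INF x\<in>carrier X. dec p x \<multimap> dec q x) else bot)\<rparr>)"

definition yoneda ::
    "('u set \<Rightarrow> ('u \<Rightarrow> 'v::comm_quantale) \<Rightarrow> 'u) \<Rightarrow> ('u, 'v) vcat \<Rightarrow> 'u \<Rightarrow> 'u"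
  where "yoneda code X = (\<lambda>x\<in>carrier X. code (carrier X) (\<lambda>z. hom X z x))"

definition yoneda_mate ::
    "('u set \<Rightarrow> ('u \<Rightarrow> 'v::comm_quantale) \<Rightarrow> 'u) \<Rightarrow> ('u, 'v) vcat \<Rightarrow> ('u, 'v) vcat \<Rightarrow>
     ('u \<Rightarrow> 'u \<Rightarrow> 'v) \<Rightarrow> 'u \<Rightarrow> 'u"
  where "yoneda_mate code X Y \<phi> = (\<lambda>y\<in>carrier Y. code (carrier X) (\<lambda>x. \<phi> x y))"

definition Ktilde ::
    "('u set \<Rightarrow> ('u \<Rightarrow> 'v::comm_quantale) \<Rightarrow> 'u) \<Rightarrow> (('u, 'v) vcat, 'u \<Rightarrow> 'u) assignment \<Rightarrow>
     (('u, 'v) vcat, 'u \<Rightarrow> 'u \<Rightarrow> 'v) assignment"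
  where "Ktilde code K =
    \<lparr>on_ob = on_ob K,
     on_mor = (\<lambda>X Y \<phi>.
       mod_comp (on_ob K (hat code X))
         (upper_star (on_ob K Y) (on_ob K (hat code X))
           (on_mor K Y (hat code X) (yoneda_mate code X Y \<phi>)))
         (lower_star (on_ob K X) (on_ob K (hat code X))
           (on_mor K X (hat code X) (yoneda code X))))\<rparr>"

end

theory Submission
  imports Defs
begin

text \<open>
  Since \<open>K\<close> sends \<open>hat code X\<close> to a \<open>\<V>\<close>-category, reflexivity and transitivity of its structure
  collapse the composite defining \<open>Ktilde\<close> at a module \<open>\<phi>\<close> from \<open>X\<close> to \<open>Y\<close> to a single value: at
  \<open>x\<close> and \<open>y\<close> it is \<open>hom (K X^) (K y\<^sub>X x) (K y\<^sub>\<phi> y)\<close>, where \<open>X^\<close> stands for \<open>hat code X\<close>, \<open>y\<^sub>X\<close> for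
  the Yoneda functor and \<open>y\<^sub>\<phi>\<close> for the mate of \<open>\<phi>\<close> (\<open>on_mor_Ktilde_eq\<close>). As \<open>y\<^sub>X\<close> is the mate of the
  identity module on \<open>X\<close>, the lax unit law says that \<open>K y\<^sub>X\<close> is a \<open>\<V>\<close>-functor
  (\<open>Ktilde_lax_unit\<close>).

  For the lax composition law, let \<open>\<psi>\<close> be a further module from \<open>Y\<close> to \<open>Z\<close>. Composing presheaves
  with \<open>\<phi>\<close> is a \<open>\<V>\<close>-functor \<open>\<Phi>\<close> from \<open>Y^\<close> to \<open>X^\<close> (\<open>hat_map\<close>), and it satisfies
  \<open>\<Phi> \<circ> y\<^sub>Y = y\<^sub>\<phi>\<close> (\<open>hat_map_yoneda\<close>) and \<open>\<Phi> \<circ> y\<^sub>\<psi> = y\<^bsub>\<psi>\<cdot>\<phi>\<^esub>\<close> (\<open>hat_map_yoneda_mate\<close>). The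
  \<open>\<V>\<close>-functor \<open>K \<Phi>\<close> therefore gives
  \<open>hom (K Y^) (K y\<^sub>Y y) (K y\<^sub>\<psi> z) \<le> hom (K X^) (K y\<^sub>\<phi> y) (K y\<^bsub>\<psi>\<cdot>\<phi>\<^esub> z)\<close>, and multiplying by
  \<open>hom (K X^) (K y\<^sub>X x) (K y\<^sub>\<phi> y)\<close> and using transitivity in \<open>K X^\<close> finishes the argument
  (\<open>Ktilde_lax_comp\<close>).

  Finally, for a \<open>\<V>\<close>-functor \<open>f\<close> from \<open>X\<close> to \<open>Y\<close> the mate of the module \<open>f\<^sup>*\<close> is \<open>y\<^sub>Y \<circ> f\<close>, so
  \<open>Ktilde\<close> sends \<open>f\<^sup>*\<close> to the module with value \<open>hom (K Y^) (K y\<^sub>Y y) (K y\<^sub>Y (K f x))\<close> at \<open>y\<close> and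
  \<open>x\<close>. The Yoneda functor is fully faithful, so if \<open>K\<close> preserves full fidelity, this is
  \<open>hom (K Y) y (K f x)\<close> (\<open>Ktilde_upper_star\<close>).
\<close>

section \<open>Quantale arithmetic\<close>

lemma mult_SUP: "v * (SUP i\<in>I. f i) = (SUP i\<in>I. v * f i)" for v :: "'v::comm_quantale"
  by (simp add: mult_Sup image_comp comp_def)

lemma mult_bot [simp]: "v * bot = bot" for v :: "'v::comm_quantale"
  using mult_Sup[of v "{}"] by simp

lemma bot_mult [simp]: "bot * v = bot" for v :: "'v::comm_quantale"
  using mult_bot[of v] by (simp add: mult.commute)

lemma mult_left_mono_quantale: "b \<le> c \<Longrightarrow> v * b \<le> v * c" for v :: "'v::comm_quantale"
  using mult_SUP[of v id "{b, c}"] by (simp add: sup_absorb2 le_iff_sup)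

lemma mult_mono_quantale: "a \<le> b \<Longrightarrow> c \<le> d \<Longrightarrow> a * c \<le> b * d" for a :: "'v::comm_quantale"
  by (metis mult_left_mono_quantale mult.commute order_trans)


section \<open>The category of presheaves\<close>

lemma vcat_refl: "is_vcat X \<Longrightarrow> x \<in> carrier X \<Longrightarrow> 1 \<le> hom X x x"
  by (simp add: is_vcat_def)

lemma vcat_trans:
  "is_vcat X \<Longrightarrow> x \<in> carrier X \<Longrightarrow> y \<in> carrier X \<Longrightarrow> z \<in> carrier X \<Longrightarrow>
    hom X x y * hom X y z \<le> hom X x z"
  by (simp add: is_vcat_def)

lemma carrier_hat: "carrier (hat code X) = code (carrier X) ` presheaves X"
  by (simp add: hat_def Let_def)

lemma inj_on_code:
  assumes "small_universe U code" "X \<in> VCat U"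
  shows "inj_on (code (carrier X)) (presheaves X)"
proof -
  have "inj_on (code (carrier X)) (vmaps (carrier X))"
    using assms by (simp add: small_universe_def VCat_def)
  then show ?thesis
    by (rule inj_on_subset) (auto simp: presheaves_def)
qed

lemma hom_hat:
  assumes "small_universe U code" "X \<in> VCat U" "t \<in> presheaves X" "s \<in> presheaves X"
  shows "hom (hat code X) (code (carrier X) t) (code (carrier X) s) =
    (INF x\<in>carrier X. t x \<multimap> s x)"
  using assms inj_on_code[OF assms(1,2)] by (simp add: hat_def Let_def)

lemma le_hom_hat_iff:
  assumes "small_universe U code" "X \<in> VCat U" "t \<in> presheaves X" "s \<in> presheaves X"
  shows "v \<le> hom (hat code X) (code (carrier X) t) (code (carrier X) s) \<longleftrightarrow>
    (\<forall>x\<in>carrier X. v * t x \<le> s x)"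
  by (simp add: hom_hat[OF assms] le_INF_iff le_residual_iff)

lemma hom_hat_mult_le:
  assumes "small_universe U code" "X \<in> VCat U" "t \<in> presheaves X" "s \<in> presheaves X"
    and "x \<in> carrier X"
  shows "hom (hat code X) (code (carrier X) t) (code (carrier X) s) * t x \<le> s x"
  using le_hom_hat_iff[OF assms(1-4)] assms(5) by blast

lemma hat_in_VCat:
  assumes "small_universe U code" "X \<in> VCat U"
  shows "hat code X \<in> VCat U"
proof -
  have "carrier (hat code X) \<subseteq> code (carrier X) ` vmaps (carrier X)"
    by (auto simp: carrier_hat presheaves_def)
  moreover have "code (carrier X) ` vmaps (carrier X) \<in> U"
    using assms by (simp add: small_universe_def VCat_def)
  ultimately have small: "carrier (hat code X) \<in> U"
    using assms(1) by (auto simp: small_universe_def)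
  have refl: "1 \<le> hom (hat code X) p p" if "p \<in> carrier (hat code X)" for p
    using that by (auto simp: carrier_hat le_hom_hat_iff[OF assms])
  have trans: "hom (hat code X) p q * hom (hat code X) q r \<le> hom (hat code X) p r"
    if pqr: "p \<in> carrier (hat code X)" "q \<in> carrier (hat code X)" "r \<in> carrier (hat code X)"
    for p q r
  proof -
    obtain t s u where tsu: "t \<in> presheaves X" "s \<in> presheaves X" "u \<in> presheaves X"
      and pqr_eq: "p = code (carrier X) t" "q = code (carrier X) s" "r = code (carrier X) u"
      using pqr by (auto simp: carrier_hat)
    have "hom (hat code X) p q * hom (hat code X) q r * t x \<le> u x" if x: "x \<in> carrier X" for x
    proof -
      have "hom (hat code X) p q * hom (hat code X) q r * t x =
          hom (hat code X) q r * (hom (hat code X) p q * t x)"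
        by (simp add: ac_simps)
      also have "\<dots> \<le> hom (hat code X) q r * s x"
        unfolding pqr_eq by (intro mult_left_mono_quantale hom_hat_mult_le[OF assms] tsu x)
      also have "\<dots> \<le> u x"
        unfolding pqr_eq by (intro hom_hat_mult_le[OF assms] tsu x)
      finally show ?thesis .
    qed
    then show ?thesis
      unfolding pqr_eq by (simp add: le_hom_hat_iff[OF assms] tsu)
  qed
  have "hom (hat code X) p q = bot"
    if "p \<notin> carrier (hat code X) \<or> q \<notin> carrier (hat code X)" for p q
    using that by (auto simp: hat_def Let_def)
  with refl trans small show ?thesis
    by (simp add: VCat_def is_vcat_def)
qed


section \<open>Yoneda mates\<close>

lemma vmodule_identity: "is_vcat X \<Longrightarrow> vmodule X X (hom X)"
  by (auto simp: is_vcat_def vmodule_def)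

lemma vmodule_column_presheaf:
  "vmodule X Y \<phi> \<Longrightarrow> y \<in> carrier Y \<Longrightarrow> (\<lambda>x. \<phi> x y) \<in> presheaves X"
  by (auto simp: vmodule_def presheaves_def vmaps_def)

lemma yoneda_eq_mate: "yoneda code X = yoneda_mate code X X (hom X)"
  by (simp add: yoneda_def yoneda_mate_def)

lemma vfunctor_yoneda_mate:
  assumes "small_universe U code" "X \<in> VCat U" "vmodule X Y \<phi>"
  shows "vfunctor Y (hat code X) (yoneda_mate code X Y \<phi>)"
  using assms(3)
  by (auto simp: vfunctor_def yoneda_mate_def carrier_hat vmodule_column_presheaf
      le_hom_hat_iff[OF assms(1,2)] vmodule_def mult.commute)

lemma vfunctor_yoneda:
  assumes "small_universe U code" "X \<in> VCat U"
  shows "vfunctor X (hat code X) (yoneda code X)"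
  using assms
  by (auto simp: yoneda_eq_mate VCat_def intro: vfunctor_yoneda_mate vmodule_identity)

lemma fully_faithful_yoneda:
  assumes "small_universe U code" "X \<in> VCat U"
  shows "fully_faithful X (hat code X) (yoneda code X)"
proof -
  have X: "is_vcat X"
    using assms(2) by (simp add: VCat_def)
  have "hom (hat code X) (yoneda code X x) (yoneda code X y) \<le> hom X x y"
    if xy: "x \<in> carrier X" "y \<in> carrier X" for x y
  proof -
    let ?v = "hom (hat code X) (yoneda code X x) (yoneda code X y)"
    \<comment> \<open>Yoneda: evaluate the infimum defining \<open>?v\<close> at \<open>x\<close>, where the presheaf of \<open>x\<close> is at least \<open>1\<close>.\<close>
    have "?v = ?v * 1"
      by simp
    also have "\<dots> \<le> ?v * hom X x x"
      by (intro mult_left_mono_quantale vcat_refl X xy)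
    also have "\<dots> \<le> hom X x y"
      using hom_hat_mult_le[OF assms vmodule_column_presheaf vmodule_column_presheaf,
          OF vmodule_identity[OF X] _ vmodule_identity[OF X]] xy
      by (simp add: yoneda_def)
    finally show ?thesis .
  qed
  then show ?thesis
    using vfunctor_yoneda[OF assms]
    by (auto simp: fully_faithful_def vfunctor_def intro!: antisym)
qed

lemma yoneda_mate_upper_star:
  assumes "vfunctor X Y f" "is_vcat Y"
  shows "yoneda_mate code Y X (upper_star X Y f) = compose (carrier X) (yoneda code Y) f"
proof (rule ext)
  fix x
  show "yoneda_mate code Y X (upper_star X Y f) x = compose (carrier X) (yoneda code Y) f x"
  proof (cases "x \<in> carrier X")
    case True
    with assms(1) have "f x \<in> carrier Y"
      by (auto simp: vfunctor_def)
    moreover have "(\<lambda>y. upper_star X Y f y x) = (\<lambda>y. hom Y y (f x))"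
      using True assms(2) by (auto simp: upper_star_def is_vcat_def)
    ultimately show ?thesis
      using True by (simp add: yoneda_mate_def yoneda_def compose_def)
  qed (simp add: yoneda_mate_def compose_def)
qed

lemma vmodule_upper_star:
  assumes "vfunctor X Y f" "is_vcat Y" "is_vcat X"
  shows "vmodule Y X (upper_star X Y f)"
proof -
  have f: "f x \<in> carrier Y" if "x \<in> carrier X" for x
    using assms(1) that by (auto simp: vfunctor_def)
  have "hom Y y (f x) * hom X x x' \<le> hom Y y (f x')"
    if "y \<in> carrier Y" "x \<in> carrier X" "x' \<in> carrier X" for x x' y
  proof -
    have "hom Y y (f x) * hom X x x' \<le> hom Y y (f x) * hom Y (f x) (f x')"
      using assms(1) that by (intro mult_left_mono_quantale) (simp add: vfunctor_def)
    also have "\<dots> \<le> hom Y y (f x')"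
      using that by (intro vcat_trans assms(2) f)
    finally show ?thesis .
  qed
  then show ?thesis
    using assms(2) f by (auto simp: vmodule_def upper_star_def intro: vcat_trans)
qed


section \<open>Composing presheaves with a module\<close>

text \<open>
  A presheaf \<open>t\<close> on \<open>Y\<close> is a module from \<open>Y\<close> to the unit \<open>\<V>\<close>-category; precomposing it with a
  module \<open>\<phi>\<close> from \<open>X\<close> to \<open>Y\<close> yields a presheaf on \<open>X\<close>.
\<close>

definition presheaf_comp ::
    "('u, 'v::comm_quantale) vcat \<Rightarrow> ('u \<Rightarrow> 'u \<Rightarrow> 'v) \<Rightarrow> ('u \<Rightarrow> 'v) \<Rightarrow> 'u \<Rightarrow> 'v"
  where "presheaf_comp Y \<phi> t = (\<lambda>x. SUP y\<in>carrier Y. \<phi> x y * t y)"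

text \<open>The \<open>\<V>\<close>-functor from \<open>hat code Y\<close> to \<open>hat code X\<close> given by \<open>presheaf_comp Y \<phi>\<close> on codes.\<close>

definition hat_map ::
    "('u set \<Rightarrow> ('u \<Rightarrow> 'v::comm_quantale) \<Rightarrow> 'u) \<Rightarrow> ('u, 'v) vcat \<Rightarrow> ('u, 'v) vcat \<Rightarrow>
     ('u \<Rightarrow> 'u \<Rightarrow> 'v) \<Rightarrow> 'u \<Rightarrow> 'u"
  where "hat_map code X Y \<phi> = (\<lambda>p\<in>carrier (hat code Y).
    code (carrier X) (presheaf_comp Y \<phi> (inv_into (presheaves Y) (code (carrier Y)) p)))"

text \<open>The presheaf condition only involves the action of \<open>X\<close> on \<open>\<phi>\<close>, so \<open>t\<close> is arbitrary.\<close>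

lemma presheaf_comp_in_presheaves:
  assumes "vmodule X Y \<phi>"
  shows "presheaf_comp Y \<phi> t \<in> presheaves X"
proof -
  have "hom X x' x * presheaf_comp Y \<phi> t x \<le> presheaf_comp Y \<phi> t x'"
    if "x' \<in> carrier X" "x \<in> carrier X" for x x'
    unfolding presheaf_comp_def mult_SUP
  proof (rule SUP_subset_mono[OF order_refl])
    fix y assume "y \<in> carrier Y"
    with assms that have "hom X x' x * \<phi> x y * t y \<le> \<phi> x' y * t y"
      by (intro mult_mono_quantale) (auto simp: vmodule_def)
    with \<open>y \<in> carrier Y\<close> show "hom X x' x * (\<phi> x y * t y) \<le> \<phi> x' y * t y"
      by (simp add: mult.assoc)
  qed
  moreover have "presheaf_comp Y \<phi> t x = bot" if "x \<notin> carrier X" for x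
    using assms that by (simp add: presheaf_comp_def vmodule_def)
  ultimately show ?thesis
    by (simp add: presheaves_def vmaps_def)
qed

lemma hat_map_code:
  assumes "small_universe U code" "Y \<in> VCat U" "t \<in> presheaves Y"
  shows "hat_map code X Y \<phi> (code (carrier Y) t) = code (carrier X) (presheaf_comp Y \<phi> t)"
  using assms(3) inj_on_code[OF assms(1,2)] by (simp add: hat_map_def carrier_hat)

lemma vfunctor_hat_map:
  assumes "small_universe U code" "X \<in> VCat U" "Y \<in> VCat U" "vmodule X Y \<phi>"
  shows "vfunctor (hat code Y) (hat code X) (hat_map code X Y \<phi>)"
proof -
  have mono: "hom (hat code Y) (code (carrier Y) t) (code (carrier Y) s)
      \<le> hom (hat code X) (code (carrier X) (presheaf_comp Y \<phi> t))
          (code (carrier X) (presheaf_comp Y \<phi> s))" (is "?v \<le> _")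
    if ts: "t \<in> presheaves Y" "s \<in> presheaves Y" for t s
  proof -
    have "?v * presheaf_comp Y \<phi> t x \<le> presheaf_comp Y \<phi> s x" for x
      unfolding presheaf_comp_def mult_SUP
    proof (rule SUP_subset_mono[OF order_refl])
      fix y assume y: "y \<in> carrier Y"
      have "\<phi> x y * (?v * t y) \<le> \<phi> x y * s y"
        by (intro mult_left_mono_quantale hom_hat_mult_le[OF assms(1,3)] ts y)
      with y show "?v * (\<phi> x y * t y) \<le> \<phi> x y * s y"
        by (simp add: mult.left_commute)
    qed
    then show ?thesis
      by (simp add: le_hom_hat_iff[OF assms(1,2)] presheaf_comp_in_presheaves[OF assms(4)])
  qed
  have "hat_map code X Y \<phi> \<in> carrier (hat code Y) \<rightarrow>\<^sub>E carrier (hat code X)"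
    using presheaf_comp_in_presheaves[OF assms(4)] by (auto simp: hat_map_def carrier_hat)
  with mono show ?thesis
    by (auto simp: vfunctor_def carrier_hat hat_map_code[OF assms(1,3)])
qed

text \<open>
  Mates turn composition of modules into composition of functions. With the identity module for
  \<open>\<psi>\<close> this describes the value of \<open>hat_map\<close> on representable presheaves (\<open>hat_map_yoneda\<close> below).
\<close>

lemma hat_map_yoneda_mate:
  assumes "small_universe U code" "Y \<in> VCat U" "vmodule Y Z \<psi>"
  shows "compose (carrier Z) (hat_map code X Y \<phi>) (yoneda_mate code Y Z \<psi>) =
    yoneda_mate code X Z (mod_comp Y \<psi> \<phi>)"
  by (auto simp: compose_def yoneda_mate_def hat_map_code[OF assms(1,2)]
      vmodule_column_presheaf[OF assms(3)] presheaf_comp_def mod_comp_def)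

lemma mod_comp_identity:
  assumes "is_vcat Y" "vmodule X Y \<phi>"
  shows "mod_comp Y (hom Y) \<phi> = \<phi>"
proof (intro ext)
  fix x y
  show "mod_comp Y (hom Y) \<phi> x y = \<phi> x y"
  proof (cases "x \<in> carrier X \<and> y \<in> carrier Y")
    case True
    have "\<phi> x y = \<phi> x y * 1"
      by simp
    also have "\<dots> \<le> \<phi> x y * hom Y y y"
      using True assms(1) by (intro mult_left_mono_quantale vcat_refl) auto
    also have "\<dots> \<le> mod_comp Y (hom Y) \<phi> x y"
      unfolding mod_comp_def using True by (intro SUP_upper) auto
    finally have "\<phi> x y \<le> mod_comp Y (hom Y) \<phi> x y" .
    moreover have "mod_comp Y (hom Y) \<phi> x y \<le> \<phi> x y"
      unfolding mod_comp_def using True assms(2) by (intro SUP_least) (simp add: vmodule_def)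
    ultimately show ?thesis
      by (rule antisym[rotated])
  next
    case False
    with assms have "\<phi> x y = bot" "\<And>y'. \<phi> x y' * hom Y y' y = bot"
      by (auto simp: vmodule_def is_vcat_def)
    then show ?thesis
      by (simp add: mod_comp_def)
  qed
qed

lemma hat_map_yoneda:
  assumes "small_universe U code" "Y \<in> VCat U" "vmodule X Y \<phi>"
  shows "compose (carrier Y) (hat_map code X Y \<phi>) (yoneda code Y) = yoneda_mate code X Y \<phi>"
proof -
  have Y: "is_vcat Y"
    using assms(2) by (simp add: VCat_def)
  show ?thesis
    unfolding yoneda_eq_mate hat_map_yoneda_mate[OF assms(1,2) vmodule_identity[OF Y]]
      mod_comp_identity[OF Y assms(3)] ..
qed

lemma vmodule_mod_comp:
  assumes "vmodule X Y \<phi>" "vmodule Y Z \<psi>"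
  shows "vmodule X Z (mod_comp Y \<psi> \<phi>)"
proof -
  \<comment> \<open>Each column of the composite is the composite of a column of \<open>\<psi>\<close> with \<open>\<phi>\<close>.\<close>
  have "hom X x' x * mod_comp Y \<psi> \<phi> x z \<le> mod_comp Y \<psi> \<phi> x' z"
    if "x' \<in> carrier X" "x \<in> carrier X" for x x' z
    using presheaf_comp_in_presheaves[OF assms(1), of "\<lambda>y. \<psi> y z"] that
    by (simp add: presheaves_def presheaf_comp_def mod_comp_def)
  moreover have "mod_comp Y \<psi> \<phi> x z * hom Z z z' \<le> mod_comp Y \<psi> \<phi> x z'"
    if z: "z \<in> carrier Z" "z' \<in> carrier Z" for x z z'
  proof -
    have "mod_comp Y \<psi> \<phi> x z * hom Z z z' =
        (SUP y\<in>carrier Y. hom Z z z' * (\<phi> x y * \<psi> y z))"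
      by (simp only: mod_comp_def mult_SUP mult.commute[of _ "hom Z z z'"])
    also have "\<dots> \<le> mod_comp Y \<psi> \<phi> x z'"
      unfolding mod_comp_def
    proof (rule SUP_subset_mono[OF order_refl])
      fix y assume y: "y \<in> carrier Y"
      with assms(2) z have "\<phi> x y * (\<psi> y z * hom Z z z') \<le> \<phi> x y * \<psi> y z'"
        by (intro mult_left_mono_quantale) (simp add: vmodule_def)
      with y show "hom Z z z' * (\<phi> x y * \<psi> y z) \<le> \<phi> x y * \<psi> y z'"
        by (simp add: ac_simps)
    qed
    finally show ?thesis .
  qed
  moreover have "mod_comp Y \<psi> \<phi> x z = bot" if "x \<notin> carrier X \<or> z \<notin> carrier Z" for x z
    using assms that by (auto simp: mod_comp_def vmodule_def)
  ultimately show ?thesis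
    by (simp add: vmodule_def)
qed


section \<open>Modules represented by a pair of functors\<close>

text \<open>
  For \<open>\<V>\<close>-functors \<open>g\<close> from \<open>A\<close> to \<open>C\<close> and \<open>h\<close> from \<open>B\<close> to \<open>C\<close>, the composite \<open>h\<^sup>* \<cdot> g\<^sub>*\<close> is the
  restriction of the structure of \<open>C\<close> along \<open>g\<close> and \<open>h\<close>.
\<close>

lemma upper_star_comp_lower_star:
  assumes "is_vcat C" "vfunctor A C g" "a \<in> carrier A" "vfunctor B C h" "b \<in> carrier B"
  shows "mod_comp C (upper_star B C h) (lower_star A C g) a b = hom C (g a) (h b)"
proof -
  have ga: "g a \<in> carrier C" and hb: "h b \<in> carrier C"
    using assms by (auto simp: vfunctor_def)
  have "mod_comp C (upper_star B C h) (lower_star A C g) a b =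
      (SUP c\<in>carrier C. hom C (g a) c * hom C c (h b))"
    using assms(3,5) by (simp add: mod_comp_def upper_star_def lower_star_def)
  also have "\<dots> = hom C (g a) (h b)"
  proof (rule antisym)
    show "(SUP c\<in>carrier C. hom C (g a) c * hom C c (h b)) \<le> hom C (g a) (h b)"
      by (intro SUP_least vcat_trans assms(1) ga hb)
    have "1 * hom C (g a) (h b) \<le> hom C (g a) (g a) * hom C (g a) (h b)"
      by (intro mult_mono_quantale vcat_refl assms(1) ga order_refl)
    also have "\<dots> \<le> (SUP c\<in>carrier C. hom C (g a) c * hom C c (h b))"
      using ga by (rule SUP_upper)
    finally show "hom C (g a) (h b) \<le> (SUP c\<in>carrier C. hom C (g a) c * hom C c (h b))"
      by simp
  qed
  finally show ?thesis .
qed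

lemma upper_star_comp_lower_star_outside:
  assumes "a \<notin> carrier A \<or> b \<notin> carrier B"
  shows "mod_comp C (upper_star B C h) (lower_star A C g) a b = bot"
  using assms by (auto simp: mod_comp_def upper_star_def lower_star_def)

lemma vmodule_lower_star:
  assumes "vfunctor A C g" "is_vcat C"
  shows "vmodule A C (lower_star A C g)"
proof -
  have g: "g a \<in> carrier C" if "a \<in> carrier A" for a
    using assms(1) that by (auto simp: vfunctor_def)
  have "hom A a' a * hom C (g a) c \<le> hom C (g a') c"
    if "a \<in> carrier A" "a' \<in> carrier A" "c \<in> carrier C" for a a' c
  proof -
    have "hom A a' a * hom C (g a) c \<le> hom C (g a') (g a) * hom C (g a) c"
      using assms(1) that by (intro mult_mono_quantale) (simp_all add: vfunctor_def)
    also have "\<dots> \<le> hom C (g a') c"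
      using that by (intro vcat_trans assms(2) g)
    finally show ?thesis .
  qed
  then show ?thesis
    using assms(2) g by (auto simp: vmodule_def lower_star_def intro: vcat_trans)
qed


section \<open>The lax functor induced by a functor\<close>

lemma VCat_functor_ob: "VCat_functor U K \<Longrightarrow> X \<in> VCat U \<Longrightarrow> on_ob K X \<in> VCat U"
  by (simp add: VCat_functor_def)

lemma VCat_functor_mor:
  "VCat_functor U K \<Longrightarrow> X \<in> VCat U \<Longrightarrow> Y \<in> VCat U \<Longrightarrow> vfunctor X Y f \<Longrightarrow>
    vfunctor (on_ob K X) (on_ob K Y) (on_mor K X Y f)"
  by (simp add: VCat_functor_def)

lemma VCat_functor_comp_apply:
  assumes "VCat_functor U K" "X \<in> VCat U" "Y \<in> VCat U" "Z \<in> VCat U"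
    and "vfunctor X Y f" "vfunctor Y Z g" "x \<in> carrier (on_ob K X)"
  shows "on_mor K X Z (compose (carrier X) g f) x = on_mor K Y Z g (on_mor K X Y f x)"
proof -
  have "on_mor K X Z (compose (carrier X) g f) =
      compose (carrier (on_ob K X)) (on_mor K Y Z g) (on_mor K X Y f)"
    using assms by (simp add: VCat_functor_def)
  then show ?thesis
    using assms(7) by (simp add: compose_def)
qed

lemma on_ob_Ktilde [simp]: "on_ob (Ktilde code K) = on_ob K"
  by (simp add: Ktilde_def)

lemma on_mor_Ktilde_eq:
  assumes "small_universe U code" "VCat_functor U K" "X \<in> VCat U" "Y \<in> VCat U" "vmodule X Y \<phi>"
    and "x \<in> carrier (on_ob K X)" "y \<in> carrier (on_ob K Y)"
  shows "on_mor (Ktilde code K) X Y \<phi> x y =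
    hom (on_ob K (hat code X)) (on_mor K X (hat code X) (yoneda code X) x)
      (on_mor K Y (hat code X) (yoneda_mate code X Y \<phi>) y)"
proof -
  note hat = hat_in_VCat[OF assms(1,3)]
  have "is_vcat (on_ob K (hat code X))"
    using VCat_functor_ob[OF assms(2) hat] by (simp add: VCat_def)
  moreover have "vfunctor (on_ob K X) (on_ob K (hat code X))
      (on_mor K X (hat code X) (yoneda code X))"
    by (intro VCat_functor_mor[OF assms(2)] vfunctor_yoneda[OF assms(1)] assms(3) hat)
  moreover have "vfunctor (on_ob K Y) (on_ob K (hat code X))
      (on_mor K Y (hat code X) (yoneda_mate code X Y \<phi>))"
    by (intro VCat_functor_mor[OF assms(2)] vfunctor_yoneda_mate[OF assms(1)] assms(3-5) hat)
  ultimately show ?thesis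
    using assms(6,7) by (simp add: Ktilde_def upper_star_comp_lower_star)
qed

lemma on_mor_Ktilde_outside:
  "x \<notin> carrier (on_ob K X) \<or> y \<notin> carrier (on_ob K Y) \<Longrightarrow>
    on_mor (Ktilde code K) X Y \<phi> x y = bot"
  by (simp add: Ktilde_def upper_star_comp_lower_star_outside)

lemma vmodule_Ktilde:
  assumes "small_universe U code" "VCat_functor U K" "X \<in> VCat U" "Y \<in> VCat U" "vmodule X Y \<phi>"
  shows "vmodule (on_ob K X) (on_ob K Y) (on_mor (Ktilde code K) X Y \<phi>)"
proof -
  note hat = hat_in_VCat[OF assms(1,3)]
  have cats: "is_vcat (on_ob K (hat code X))" "is_vcat (on_ob K Y)"
    using VCat_functor_ob[OF assms(2)] hat assms(4) by (simp_all add: VCat_def)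
  have "vfunctor (on_ob K X) (on_ob K (hat code X)) (on_mor K X (hat code X) (yoneda code X))"
    by (intro VCat_functor_mor[OF assms(2)] vfunctor_yoneda[OF assms(1)] assms(3) hat)
  moreover have "vfunctor (on_ob K Y) (on_ob K (hat code X))
      (on_mor K Y (hat code X) (yoneda_mate code X Y \<phi>))"
    by (intro VCat_functor_mor[OF assms(2)] vfunctor_yoneda_mate[OF assms(1)] assms(3-5) hat)
  ultimately show ?thesis
    using cats
    by (auto simp: Ktilde_def intro!: vmodule_mod_comp vmodule_lower_star vmodule_upper_star)
qed

lemma Ktilde_lax_unit:
  assumes "small_universe U code" "VCat_functor U K" "X \<in> VCat U"
  shows "hom (on_ob K X) \<le> on_mor (Ktilde code K) X X (hom X)"
proof (intro le_funI)
  fix x y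
  have X: "is_vcat X" "is_vcat (on_ob K X)"
    using assms(3) VCat_functor_ob[OF assms(2,3)] by (simp_all add: VCat_def)
  show "hom (on_ob K X) x y \<le> on_mor (Ktilde code K) X X (hom X) x y"
  proof (cases "x \<in> carrier (on_ob K X) \<and> y \<in> carrier (on_ob K X)")
    case True
    have "vfunctor (on_ob K X) (on_ob K (hat code X)) (on_mor K X (hat code X) (yoneda code X))"
      by (intro VCat_functor_mor[OF assms(2)] vfunctor_yoneda[OF assms(1)] assms(3)
          hat_in_VCat[OF assms(1)])
    with True show ?thesis
      by (simp add: on_mor_Ktilde_eq[OF assms(1,2,3,3) vmodule_identity[OF X(1)]]
          yoneda_eq_mate[symmetric] vfunctor_def)
  next
    case False
    with X(2) have "hom (on_ob K X) x y = bot"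
      by (auto simp: is_vcat_def)
    then show ?thesis
      by simp
  qed
qed

lemma Ktilde_lax_comp:
  assumes "small_universe U code" "VCat_functor U K"
    and XYZ: "X \<in> VCat U" "Y \<in> VCat U" "Z \<in> VCat U"
    and \<phi>: "vmodule X Y \<phi>" and \<psi>: "vmodule Y Z \<psi>"
  shows "mod_comp (on_ob K Y) (on_mor (Ktilde code K) Y Z \<psi>) (on_mor (Ktilde code K) X Y \<phi>)
    \<le> on_mor (Ktilde code K) X Z (mod_comp Y \<psi> \<phi>)"
proof (intro le_funI)
  fix x z
  let ?T = "on_mor (Ktilde code K)"
  let ?H = "hat code X"
  show "mod_comp (on_ob K Y) (?T Y Z \<psi>) (?T X Y \<phi>) x z \<le> ?T X Z (mod_comp Y \<psi> \<phi>) x z"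
    unfolding mod_comp_def[of "on_ob K Y"]
  proof (rule SUP_least)
    fix y assume y: "y \<in> carrier (on_ob K Y)"
    show "?T X Y \<phi> x y * ?T Y Z \<psi> y z \<le> ?T X Z (mod_comp Y \<psi> \<phi>) x z"
    proof (cases "x \<in> carrier (on_ob K X) \<and> z \<in> carrier (on_ob K Z)")
      case True
      then have x: "x \<in> carrier (on_ob K X)" and z: "z \<in> carrier (on_ob K Z)"
        by auto
      note hatX = hat_in_VCat[OF assms(1) XYZ(1)]
      note hatY = hat_in_VCat[OF assms(1) XYZ(2)]
      note fun_yX = vfunctor_yoneda[OF assms(1) XYZ(1)]
      note fun_yY = vfunctor_yoneda[OF assms(1) XYZ(2)]
      note fun_\<phi> = vfunctor_yoneda_mate[OF assms(1) XYZ(1) \<phi>]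
      note fun_\<psi> = vfunctor_yoneda_mate[OF assms(1) XYZ(2) \<psi>]
      note \<psi>\<phi> = vmodule_mod_comp[OF \<phi> \<psi>]
      note fun_\<psi>\<phi> = vfunctor_yoneda_mate[OF assms(1) XYZ(1) \<psi>\<phi>]
      note fun_\<Phi> = vfunctor_hat_map[OF assms(1) XYZ(1,2) \<phi>]
      define \<Phi> where "\<Phi> = on_mor K (hat code Y) ?H (hat_map code X Y \<phi>)"
      define u where "u = on_mor K X ?H (yoneda code X) x"
      define v where "v = on_mor K Y ?H (yoneda_mate code X Y \<phi>) y"
      define w where "w = on_mor K Z ?H (yoneda_mate code X Z (mod_comp Y \<psi> \<phi>)) z"
      define v' where "v' = on_mor K Y (hat code Y) (yoneda code Y) y"
      define w' where "w' = on_mor K Z (hat code Y) (yoneda_mate code Y Z \<psi>) z"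
      have in_carrier: "u \<in> carrier (on_ob K ?H)" "v \<in> carrier (on_ob K ?H)"
        "w \<in> carrier (on_ob K ?H)"
        using VCat_functor_mor[OF assms(2) XYZ(1) hatX fun_yX]
          VCat_functor_mor[OF assms(2) XYZ(2) hatX fun_\<phi>]
          VCat_functor_mor[OF assms(2) XYZ(3) hatX fun_\<psi>\<phi>] x y z
        by (auto simp: vfunctor_def u_def v_def w_def)
      have in_carrier': "v' \<in> carrier (on_ob K (hat code Y))"
        "w' \<in> carrier (on_ob K (hat code Y))"
        using VCat_functor_mor[OF assms(2) XYZ(2) hatY fun_yY]
          VCat_functor_mor[OF assms(2) XYZ(3) hatY fun_\<psi>] y z
        by (auto simp: vfunctor_def v'_def w'_def)
      have v: "v = \<Phi> v'"
        unfolding v_def v'_def \<Phi>_def hat_map_yoneda[OF assms(1) XYZ(2) \<phi>, symmetric]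
        by (rule VCat_functor_comp_apply[OF assms(2) XYZ(2) hatY hatX fun_yY fun_\<Phi> y])
      have w: "w = \<Phi> w'"
        unfolding w_def w'_def \<Phi>_def hat_map_yoneda_mate[OF assms(1) XYZ(2) \<psi>, symmetric]
        by (rule VCat_functor_comp_apply[OF assms(2) XYZ(3) hatY hatX fun_\<psi> fun_\<Phi> z])
      have "?T X Y \<phi> x y * ?T Y Z \<psi> y z =
          hom (on_ob K ?H) u v * hom (on_ob K (hat code Y)) v' w'"
        unfolding u_def v_def v'_def w'_def
        by (simp add: on_mor_Ktilde_eq[OF assms(1,2) XYZ(1,2) \<phi> x y]
            on_mor_Ktilde_eq[OF assms(1,2) XYZ(2,3) \<psi> y z])
      also have "\<dots> \<le> hom (on_ob K ?H) u v * hom (on_ob K ?H) v w"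
        using VCat_functor_mor[OF assms(2) hatY hatX fun_\<Phi>] in_carrier'
        unfolding v w by (intro mult_left_mono_quantale) (simp add: vfunctor_def \<Phi>_def)
      also have "\<dots> \<le> hom (on_ob K ?H) u w"
        using VCat_functor_ob[OF assms(2) hatX] in_carrier
        by (intro vcat_trans) (simp_all add: VCat_def)
      also have "\<dots> = ?T X Z (mod_comp Y \<psi> \<phi>) x z"
        unfolding u_def w_def by (simp add: on_mor_Ktilde_eq[OF assms(1,2) XYZ(1,3) \<psi>\<phi> x z])
      finally show ?thesis .
    next
      case False
      then have "?T X Y \<phi> x y * ?T Y Z \<psi> y z = bot"
        by (auto simp: on_mor_Ktilde_outside)
      then show ?thesis
        by simp
    qed
  qed
qed

lemma Ktilde_upper_star:
  assumes "small_universe U code" "VCat_functor U K" "preserves_full_fidelity U K"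
    and X: "X \<in> VCat U" and Y: "Y \<in> VCat U" and f: "vfunctor X Y f"
  shows "on_mor (Ktilde code K) Y X (upper_star X Y f) =
    upper_star (on_ob K X) (on_ob K Y) (on_mor K X Y f)"
proof (intro ext)
  fix y x
  have cats: "is_vcat X" "is_vcat Y"
    using X Y by (simp_all add: VCat_def)
  note hat = hat_in_VCat[OF assms(1) Y]
  let ?y = "on_mor K Y (hat code Y) (yoneda code Y)"
  show "on_mor (Ktilde code K) Y X (upper_star X Y f) y x =
    upper_star (on_ob K X) (on_ob K Y) (on_mor K X Y f) y x"
  proof (cases "y \<in> carrier (on_ob K Y) \<and> x \<in> carrier (on_ob K X)")
    case True
    then have y: "y \<in> carrier (on_ob K Y)" and x: "x \<in> carrier (on_ob K X)"
      by auto
    have fx: "on_mor K X Y f x \<in> carrier (on_ob K Y)"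
      using VCat_functor_mor[OF assms(2) X Y f] x by (auto simp: vfunctor_def)
    have ff: "fully_faithful (on_ob K Y) (on_ob K (hat code Y)) ?y"
      using assms(3) Y hat fully_faithful_yoneda[OF assms(1) Y]
      by (simp add: preserves_full_fidelity_def)
    have "on_mor (Ktilde code K) Y X (upper_star X Y f) y x =
        hom (on_ob K (hat code Y)) (?y y) (?y (on_mor K X Y f x))"
      by (simp add: on_mor_Ktilde_eq[OF assms(1,2) Y X vmodule_upper_star[OF f cats(2,1)] y x]
          yoneda_mate_upper_star[OF f cats(2)]
          VCat_functor_comp_apply[OF assms(2) X Y hat f vfunctor_yoneda[OF assms(1) Y] x])
    also have "\<dots> = hom (on_ob K Y) y (on_mor K X Y f x)"
      using ff y fx by (simp add: fully_faithful_def)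
    finally show ?thesis
      using x y by (simp add: upper_star_def)
  qed (auto simp: on_mor_Ktilde_outside upper_star_def)
qed

theorem theorem1:
  fixes U :: "'u set set"
    and code :: "'u set \<Rightarrow> ('u \<Rightarrow> 'v::comm_quantale) \<Rightarrow> 'u"
    and K :: "(('u, 'v) vcat, 'u \<Rightarrow> 'u) assignment"
  assumes "small_universe U code"
    and "VCat_functor U K"
  shows "VMod_lax_functor U (Ktilde code K) \<and>
    (\<forall>X\<in>VCat U. on_ob (Ktilde code K) X = on_ob K X) \<and>
    (preserves_full_fidelity U K \<longrightarrow>
      (\<forall>X\<in>VCat U. \<forall>Y\<in>VCat U. \<forall>f. vfunctor X Y f \<longrightarrow>
        on_mor (Ktilde code K) Y X (upper_star X Y f) =
        upper_star (on_ob K X) (on_ob K Y) (on_mor K X Y f)))"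
proof (intro conjI impI ballI allI)
  show "VMod_lax_functor U (Ktilde code K)"
    unfolding VMod_lax_functor_def on_ob_Ktilde
    using VCat_functor_ob[OF assms(2)] vmodule_Ktilde[OF assms] Ktilde_lax_unit[OF assms]
      Ktilde_lax_comp[OF assms]
    by blast
qed (simp_all add: Ktilde_upper_star[OF assms])

end
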